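(* Let $n\ge 0$ and let $B_1$ be the unit ball in $\mathbb{C}^{n+1}$. For every function $u\in\mathcal{F}(B_1)$, $$u(0)>-\infty\ \Longrightarrow\ \lambda_u(0)=0.$$
   Context: $\mathcal{F}(B_1)$ is the family of plurisubharmonic functions $u$ on $B_1$ that are locally bounded on $B_1\setminus\{0\}$ and circular symmetric, i.e. $u(e^{i\theta}z)=u(z)$ for all $\theta\in\mathbb{R}$, $z\in B_1$. For $u\in\mathcal{F}(B_1)$ and a complex direction $\zeta\in\mathbb{CP}^n$, the restriction of $u$ to the complex line through the origin in the direction $\zeta$ depends only on $r=|z|$; write it as $u(e^t,\zeta)$ with $t=\log r$. It is a non-decreasing convex function of $t\in(-\infty,0)$. For $A>0$ put $M_A(u):=\sup_{\zeta\in\mathbb{CP}^n}\partial_t^+u(e^t,\zeta)|_{t=-A}$ (right derivative), a non-negative real number, non-increasing in $A$. The maximal directional Lelong number of $u$ at the origin is $\lambda_u(0):=\lim_{A\to\infty}M_A(u)$. *)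

theory Defs
  imports "HOL-Analysis.Analysis"
begin

definition usc_on :: "'a::topological_space set \<Rightarrow> ('a \<Rightarrow> ereal) \<Rightarrow> bool" where
  "usc_on S u \<longleftrightarrow> (\<forall>x\<in>S. \<forall>c. u x < c \<longrightarrow> (\<forall>\<^sub>F y in at x within S. u y < c))"

definition locally_bounded_on :: "'a::topological_space set \<Rightarrow> ('a \<Rightarrow> ereal) \<Rightarrow> bool" where
  "locally_bounded_on S u \<longleftrightarrow>
     (\<forall>x\<in>S. \<exists>U C. open U \<and> x \<in> U \<and> (\<forall>y\<in>U \<inter> S. \<bar>u y\<bar> \<le> ereal C))"

text \<open>
  The mean of an extended real function over a circle, as the integral of the positive part
  minus the integral of the negative part. For an upper semicontinuous \<open>u < \<infinity>\<close> the first
  integral is finite, so the difference is a well-defined element of \<open>[-\<infinity>, \<infinity>)\<close>.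
\<close>

definition circle_mean :: "(complex \<Rightarrow> ereal) \<Rightarrow> complex \<Rightarrow> real \<Rightarrow> ereal" where
  "circle_mean u a r =
     (enn2ereal (\<integral>\<^sup>+\<theta>\<in>{0..2*pi}. e2ennreal (u (a + of_real r * cis \<theta>)) \<partial>lborel)
      - enn2ereal (\<integral>\<^sup>+\<theta>\<in>{0..2*pi}. e2ennreal (- u (a + of_real r * cis \<theta>)) \<partial>lborel))
     / ereal (2 * pi)"

text \<open>The function that is constantly \<open>-\<infinity>\<close> counts as (pluri)subharmonic.\<close>

definition subharmonic_on :: "complex set \<Rightarrow> (complex \<Rightarrow> ereal) \<Rightarrow> bool" where
  "subharmonic_on S u \<longleftrightarrow>
     (\<forall>x\<in>S. u x < \<infinity>) \<and> usc_on S u \<and>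
     (\<forall>a r. 0 < r \<longrightarrow> cball a r \<subseteq> S \<longrightarrow> u a \<le> circle_mean u a r)"

definition plurisubharmonic_on :: "(complex^'n) set \<Rightarrow> (complex^'n \<Rightarrow> ereal) \<Rightarrow> bool" where
  "plurisubharmonic_on S u \<longleftrightarrow>
     (\<forall>x\<in>S. u x < \<infinity>) \<and> usc_on S u \<and>
     (\<forall>a b. subharmonic_on {w. a + w *s b \<in> S} (\<lambda>w. u (a + w *s b)))"

definition circular_family :: "(complex^'n) set \<Rightarrow> (complex^'n \<Rightarrow> ereal) set" where
  "circular_family B =
     {u. plurisubharmonic_on B u \<and> locally_bounded_on (B - {0}) u \<and>
         (\<forall>\<theta>. \<forall>z\<in>B. u (cis \<theta> *s z) = u z)}"

text \<open>A point of projective space is a complex line through the origin.\<close>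

definition complex_directions :: "(complex^'n) set set" where
  "complex_directions = {vec.span {v} | v. v \<noteq> 0}"

text \<open>
  \<open>radial u \<zeta> t\<close> is the common value of \<open>u\<close> on the circle of radius \<open>e\<^sup>t\<close> in the line \<open>\<zeta>\<close>.
\<close>

definition radial :: "(complex^'n \<Rightarrow> ereal) \<Rightarrow> (complex^'n) set \<Rightarrow> real \<Rightarrow> ereal" where
  "radial u \<zeta> t = (THE c. u ` (\<zeta> \<inter> sphere 0 (exp t)) = {c})"

lemma radial_span:
  fixes u :: "complex^'n \<Rightarrow> ereal"
  assumes u: "u \<in> circular_family (ball 0 1)" and v: "norm v = 1" and t: "t < 0"
  shows "radial u (vec.span {v}) t = u (of_real (exp t) *s v)"
proof -
  have n: "norm (c *s v) = cmod c" for c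
    using v by (simp add: norm_vec_def norm_mult flip: L2_set_right_distrib)
  let ?w = "of_real (exp t) *s v"
  have w: "?w \<in> vec.span {v} \<inter> sphere 0 (exp t)"
    by (auto simp: n vec.span_singleton)
  have "u z = u ?w" if z: "z \<in> vec.span {v} \<inter> sphere 0 (exp t)" for z
  proof -
    obtain c where c: "z = c *s v" using z by (auto simp: vec.span_singleton)
    with z have "cmod c = exp t" by (simp add: n)
    then have "z = cis (Arg c) *s ?w"
      using c by (metis mult.commute rcis_cmod_Arg rcis_def vec.scale_scale)
    moreover have "?w \<in> ball 0 1" using t by (simp add: n)
    ultimately show ?thesis using u unfolding circular_family_def by blast
  qed
  with w have "u ` (vec.span {v} \<inter> sphere 0 (exp t)) = {u ?w}" by blast
  then show ?thesis by (simp add: radial_def)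
qed

text \<open>
  The restriction of a member of the family to a line is finite away from the origin, so the
  conversion to type real is harmless, and \<open>vector_derivative\<close> along \<open>at_right\<close> is the right
  derivative. The supremum is taken in the extended reals so that it is meaningful without
  presupposing boundedness.
\<close>

definition max_slope :: "(complex^'n \<Rightarrow> ereal) \<Rightarrow> real \<Rightarrow> ereal" where
  "max_slope u A =
     (SUP \<zeta>\<in>complex_directions.
        ereal (vector_derivative (\<lambda>t. real_of_ereal (radial u \<zeta> t)) (at_right (- A))))"

definition max_directional_lelong :: "(complex^'n \<Rightarrow> ereal) \<Rightarrow> ereal" where
  "max_directional_lelong u = Lim at_top (max_slope u)"

end

theory Submission
  imports Defs "HOL-Complex_Analysis.Complex_Analysis"
begin

text \<open>
  On a complex line through the origin \<open>u\<close> is a rotation invariant subharmonic function, so by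
  comparison with \<open>a + b log |w|\<close> on annuli its profile \<open>f t = u (e\<^sup>t v)\<close> is convex; being bounded
  above near \<open>-\<infinity>\<close> it is also non-decreasing. The submean inequality at the origin gives
  \<open>f t \<ge> u 0\<close>, and \<open>u \<le> C\<close> on the sphere of radius \<open>e\<^sup>-\<^sup>1\<close> by compactness. By convexity the right
  derivative of \<open>f\<close> at \<open>-A\<close> lies between \<open>0\<close> and \<open>(f (-1) - f (-A)) / (A - 1) \<le> (C - u 0) / (A - 1)\<close>,
  uniformly in the direction \<open>v\<close>.
\<close>

section \<open>Semicontinuous functions and circle means\<close>

text \<open>If no point were maximal, every \<open>x\<close> in \<open>K\<close> would have a
  neighbourhood on which \<open>h\<close> stays below some value \<open>h (p x)\<close> with
  \<open>p x\<close> in \<open>K\<close>. In a finite subcover the largest of these values is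
  attained at a point of \<open>K\<close>, which a member of the subcover forces to be smaller than
  another such value.\<close>

lemma usc_attains_max:
  fixes h :: "'a::topological_space \<Rightarrow> ereal"
  assumes "compact K" "K \<noteq> {}" "usc_on K h"
  shows "\<exists>x\<in>K. \<forall>y\<in>K. h y \<le> h x"
proof (rule ccontr)
  assume neg: "\<not> ?thesis"
  have "\<exists>U y. open U \<and> x \<in> U \<and> y \<in> K \<and> (\<forall>z\<in>U \<inter> K. h z < h y)" if x: "x \<in> K" for x
  proof -
    obtain y where y: "y \<in> K" "h x < h y" using neg x by (meson not_le)
    then have "\<forall>\<^sub>F z in at x within K. h z < h y" using assms(3) x unfolding usc_on_def by blast
    then obtain U where "open U" "x \<in> U" "\<And>z. z \<in> U \<Longrightarrow> z \<noteq> x \<Longrightarrow> z \<in> K \<Longrightarrow> h z < h y"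
      unfolding eventually_at_topological by blast
    with y show ?thesis by (metis IntE)
  qed
  then obtain U p where U: "\<And>x. x \<in> K \<Longrightarrow> open (U x) \<and> x \<in> U x \<and> p x \<in> K \<and> (\<forall>z\<in>U x \<inter> K. h z < h (p x))"
    by metis
  obtain D where D: "D \<subseteq> K" "finite D" "K \<subseteq> (\<Union>x\<in>D. U x)"
    using compactE_image[OF assms(1), of K U] U by blast
  with assms(2) have "D \<noteq> {}" by auto
  with D(2) obtain d where d: "d \<in> D" "\<And>x. x \<in> D \<Longrightarrow> h (p x) \<le> h (p d)"
    using finite_has_maximal[of "(\<lambda>x. h (p x)) ` D"] by (smt (verit, best) finite_imageI image_iff image_is_empty linorder_linear)
  then have "p d \<in> K" using D U by blast
  then obtain x where "x \<in> D" "p d \<in> U x" using D by blast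
  then have "h (p d) < h (p x)" using U D \<open>p d \<in> K\<close> by blast
  with d \<open>x \<in> D\<close> show False by (meson not_le)
qed

lemma circle_mean_mono:
  assumes "\<And>\<theta>. u (a + of_real r * cis \<theta>) \<le> v (a + of_real r * cis \<theta>)"
  shows "circle_mean u a r \<le> circle_mean v a r"
  unfolding circle_mean_def
  by (intro ereal_divide_right_mono ereal_minus_mono)
     (auto intro!: nn_integral_mono mult_right_mono e2ennreal_mono assms simp: less_eq_ennreal.rep_eq[symmetric])

text \<open>This is the imaginary part of Cauchy's integral formula: on the circle, dw / (w - a)
  becomes i d\<theta>, and Im (i F) = Re F. It evaluates the means of the harmonic majorants used
  below.\<close>

lemma circle_mean_Re_holomorphic:
  assumes F: "F holomorphic_on cball a r" and r: "0 < r"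
  shows "circle_mean (\<lambda>w. ereal (Re (F w))) a r = ereal (Re (F a))"
proof -
  define \<phi> where "\<phi> \<theta> = Re (F (a + of_real r * cis \<theta>))" for \<theta>
  have "((\<lambda>w. F w / (w - a)) has_contour_integral 2 * of_real pi * \<i> * F a) (part_circlepath a r 0 (2 * pi))"
    using Cauchy_integral_circlepath_simple[OF F, of a] r by (simp add: circlepath_def)
  then have "((\<lambda>\<theta>. F (a + of_real r * cis \<theta>) * \<i>) has_integral 2 * of_real pi * \<i> * F a) {0..2*pi}"
    using r by (subst (asm) has_contour_integral_part_circlepath_iff) auto
  from has_integral_Im[OF this] have int: "(\<phi> has_integral 2 * pi * Re (F a)) {0..2*pi}"
    by (simp add: \<phi>_def[abs_def])
  have "continuous_on {0..2*pi} (\<lambda>\<theta>. F (a + of_real r * cis \<theta>))"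
    by (rule continuous_on_compose2[OF holomorphic_on_imp_continuous_on[OF F]])
       (use r in \<open>auto intro!: continuous_intros simp: dist_norm norm_mult\<close>)
  then have "continuous_on {0..2*pi} \<phi>" unfolding \<phi>_def by (intro continuous_intros)
  then have si: "set_integrable lborel {0..2*pi} \<phi>"
    by (simp add: borel_integrable_atLeastAtMost')
  let ?G = "\<lambda>\<theta>. indicator {0..2*pi} \<theta> * \<phi> \<theta>"
  have G: "integrable lborel ?G" using si by (simp add: set_integrable_def)
  have LG: "(LINT \<theta>|lborel. ?G \<theta>) = 2 * pi * Re (F a)"
    using set_borel_integral_eq_integral(2)[OF si] int
    by (simp add: set_lebesgue_integral_def integral_unique)
  \<comment> \<open>Both parts being finite, the extended-real difference in
    \<open>circle_mean\<close> is an honest difference of reals and equals the Lebesgue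
    integral.\<close>
  have fin: "(\<integral>\<^sup>+\<theta>. ennreal (?G \<theta>) \<partial>lborel) \<noteq> \<infinity>" "(\<integral>\<^sup>+\<theta>. ennreal (- ?G \<theta>) \<partial>lborel) \<noteq> \<infinity>"
    using G by (auto simp: real_integrable_def)
  have e: "(\<integral>\<^sup>+\<theta>\<in>{0..2*pi}. e2ennreal (ereal (Re (F (a + of_real r * cis \<theta>)))) \<partial>lborel) = (\<integral>\<^sup>+\<theta>. ennreal (?G \<theta>) \<partial>lborel)"
     "(\<integral>\<^sup>+\<theta>\<in>{0..2*pi}. e2ennreal (- ereal (Re (F (a + of_real r * cis \<theta>)))) \<partial>lborel) = (\<integral>\<^sup>+\<theta>. ennreal (- ?G \<theta>) \<partial>lborel)"
    by (auto intro!: nn_integral_cong simp: \<phi>_def indicator_def e2ennreal_ereal)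
  have "enn2ereal (\<integral>\<^sup>+\<theta>. ennreal (?G \<theta>) \<partial>lborel) - enn2ereal (\<integral>\<^sup>+\<theta>. ennreal (- ?G \<theta>) \<partial>lborel)
     = ereal (2 * pi * Re (F a))"
    unfolding LG[symmetric] real_lebesgue_integral_def[OF G] using fin
    by (cases "\<integral>\<^sup>+\<theta>. ennreal (?G \<theta>) \<partial>lborel"; cases "\<integral>\<^sup>+\<theta>. ennreal (- ?G \<theta>) \<partial>lborel") (auto simp: enn2ereal_ennreal)
  then show ?thesis unfolding circle_mean_def e by simp
qed

text \<open>Passes from the punctured neighbourhoods of \<open>usc_on\<close> to full ones, so that
  the bound can be composed with any map tending to \<open>x\<close>, including one that takes the
  value \<open>x\<close>.\<close>

lemma usc_on_open_eventually_nhds: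
  assumes "usc_on S u" "open S" "x \<in> S" "u x < c"
  shows "\<forall>\<^sub>F y in nhds x. u y < c"
proof -
  have "\<forall>\<^sub>F y in at x. u y < c"
    using assms unfolding usc_on_def by (metis at_within_open)
  then show ?thesis using assms(4) by (auto simp: eventually_at_filter elim: eventually_mono)
qed

section \<open>Convexity of the radial profile\<close>

text \<open>A maximum principle argument. If \<open>f\<close> exceeds its chord \<open>l\<close>
  somewhere, then \<open>f + q\<close>, with \<open>q\<close> the negative chord plus a small
  perturbation, has an interior maximum at some \<open>s\<close>. This bounds \<open>g\<close> on a
  small circle about \<open>exp s\<close> by the real part of a holomorphic \<open>F\<close> whose
  value at the centre is too small for the submean inequality.\<close>

lemma convex_on_radial_subharmonic:
  fixes g :: "complex \<Rightarrow> ereal"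
  assumes sh: "subharmonic_on (ball 0 1) g"
    and rot: "\<And>\<theta> w. w \<in> ball 0 1 \<Longrightarrow> g (cis \<theta> * w) = g w"
    and fin: "\<And>w. w \<in> ball 0 1 \<Longrightarrow> w \<noteq> 0 \<Longrightarrow> \<bar>g w\<bar> \<noteq> \<infinity>"
  shows "convex_on {..<0} (\<lambda>t. real_of_ereal (g (of_real (exp t))))"
proof -
  define f where "f t = real_of_ereal (g (of_real (exp t)))" for t
  have gf: "g (of_real (exp t)) = ereal (f t)" if "t < 0" for t
    using fin[of "of_real (exp t)"] that by (simp add: f_def ereal_real)
  have gl: "g w = ereal (f (ln (cmod w)))" if "w \<noteq> 0" "cmod w < 1" for w
  proof -
    have "g w = g (cis (Arg w) * of_real (cmod w))"
      by (metis mult.commute rcis_cmod_Arg rcis_def)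
    also have "\<dots> = g (of_real (exp (ln (cmod w))))" using that by (subst rot) auto
    also have "\<dots> = ereal (f (ln (cmod w)))" using that by (intro gf) simp
    finally show ?thesis .
  qed
  have usc: "usc_on {t1..t2} (\<lambda>t. ereal (f t + q t))"
    if "t2 < 0" and q: "continuous_on {t1..t2} q" for t1 t2 q
    unfolding usc_on_def
  proof (intro ballI allI impI)
    fix t c assume t: "t \<in> {t1..t2}" and c: "ereal (f t + q t) < c"
    obtain c' where c': "f t + q t < c'" "ereal c' < c" using ereal_dense2[OF c] by auto
    \<comment> \<open>The real slack below \<open>c\<close> is shared equally between the
      oscillation of \<open>f\<close> and that of \<open>q\<close>.\<close>
    define \<delta> where "\<delta> = (c' - f t - q t) / 2"
    have \<delta>: "\<delta> > 0" using c' by (simp add: \<delta>_def)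
    have "\<forall>\<^sub>F w in nhds (of_real (exp t)). g w < ereal (f t + \<delta>)"
      by (rule usc_on_open_eventually_nhds[of "ball 0 1"])
         (use sh t that(1) \<delta> in \<open>auto simp: subharmonic_on_def gf\<close>)
    moreover have "((\<lambda>t. complex_of_real (exp t)) \<longlongrightarrow> of_real (exp t)) (at t within {t1..t2})"
      by (intro tendsto_intros)
    ultimately have 1: "\<forall>\<^sub>F s in at t within {t1..t2}. g (of_real (exp s)) < ereal (f t + \<delta>)"
      by (rule eventually_compose_filterlim)
    have "(q \<longlongrightarrow> q t) (at t within {t1..t2})" using q t by (simp add: continuous_on_def)
    then have 2: "\<forall>\<^sub>F s in at t within {t1..t2}. q s < q t + \<delta>"
      by (rule order_tendstoD) (use \<delta> in simp)
    have 3: "\<forall>\<^sub>F s in at t within {t1..t2}. s \<in> {t1..t2}"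
      by (simp add: eventually_at_filter)
    from 1 2 3 show "\<forall>\<^sub>F s in at t within {t1..t2}. ereal (f s + q s) < c"
    proof eventually_elim
      case (elim s)
      then have "f s < f t + \<delta>" using that(1) by (simp add: gf)
      with elim have "f s + q s < c'" by (simp add: \<delta>_def field_simps)
      then have "ereal (f s + q s) < ereal c'" by simp
      with c'(2) show ?case by (rule less_trans[rotated])
    qed
  qed
  have "convex_on {..<0} f"
  proof (rule convex_on_linorderI)
    fix x t1 t2 :: real
    assume x: "0 < x" "x < 1" and t: "t1 \<in> {..<0}" "t2 \<in> {..<0}" "t1 < t2"
    show "f ((1 - x) *\<^sub>R t1 + x *\<^sub>R t2) \<le> (1 - x) * f t1 + x * f t2"
    proof (rule ccontr)
      assume neg: "\<not> ?thesis"
      define m where "m = (1 - x) * t1 + x * t2"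
      have m1: "m = t1 + x * (t2 - t1)" by (simp add: m_def algebra_simps)
      have "0 < x * (t2 - t1)" "x * (t2 - t1) < 1 * (t2 - t1)"
        using x t by (auto intro!: mult_strict_right_mono)
      then have m: "t1 < m" "m < t2" by (simp_all add: m1)
      define b where "b = (f t2 - f t1) / (t2 - t1)"
      define l where "l s = f t1 + b * (s - t1)" for s
      have l: "l t1 = f t1" "l t2 = f t2" using t by (auto simp: l_def b_def)
      have "l m = f t1 + x * (b * (t2 - t1))" by (simp add: l_def m1)
      also have "b * (t2 - t1) = f t2 - f t1" using t by (simp add: b_def)
      finally have lm: "l m = (1 - x) * f t1 + x * f t2" by (simp add: algebra_simps)
      \<comment> \<open>With half of the excess over the chord, \<open>f + q\<close> is above
        \<open>2 * \<epsilon>\<close> at \<open>m\<close>, whereas at the endpoints it is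
        \<open>\<epsilon> * exp (2 * t)\<close>, at most \<open>\<epsilon>\<close> since
        \<open>t < 0\<close>. The maximum is therefore interior.\<close>
      define \<epsilon> where "\<epsilon> = (f m - l m) / 2"
      have \<epsilon>: "\<epsilon> > 0" using neg unfolding \<epsilon>_def lm by (simp add: m_def)
      \<comment> \<open>The term \<open>\<epsilon> |w|\<^sup>2\<close>, with \<open>|w| = e\<^sup>s\<close>, makes the comparison function strictly subharmonic,
        so that an interior maximum violates the submean inequality.\<close>
      define q where "q s = \<epsilon> * exp (2 * s) - l s" for s
      have "continuous_on {t1..t2} q" unfolding q_def l_def by (intro continuous_intros)
      then obtain s where s: "s \<in> {t1..t2}" and smax: "\<And>y. y \<in> {t1..t2} \<Longrightarrow> f y + q y \<le> f s + q s"
        using usc_attains_max[OF _ _ usc, of t1 t2 q] t by auto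
      have "f s + q s \<ge> f m + q m" using smax m by simp
      moreover have "f m + q m > \<epsilon>" using \<epsilon> using \<epsilon>_def
        by (simp add: q_def) (smt (verit) exp_gt_zero field_sum_of_halves mult_pos_pos)
      ultimately have big: "f s + q s > \<epsilon>" by simp
      have "f t1 + q t1 \<le> \<epsilon>" "f t2 + q t2 \<le> \<epsilon>"
        using \<epsilon> t by (simp_all add: q_def l)
      with big s have s': "t1 < s" "s < t2" by (auto simp: less_le)
      define e where "e = exp s"
      define w0 where "w0 = complex_of_real e"
      have e: "e > 0" "exp t1 < e" "e < exp t2" using s' by (auto simp: e_def)
      \<comment> \<open>The modulus conditions keep \<open>ln (cmod w)\<close> between
        \<open>t1\<close> and \<open>t2\<close>, where \<open>smax\<close> applies; the half-plane
        keeps \<open>w\<close> off the branch cut of \<open>Ln\<close>.\<close>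
      define N where "N = {w. exp t1 < cmod w} \<inter> {w. cmod w < exp t2} \<inter> {w. 0 < Re w}"
      have "open N" unfolding N_def by (intro open_Int open_Collect_less continuous_intros)
      moreover have "w0 \<in> N" using e by (auto simp: N_def w0_def)
      ultimately obtain \<rho> where \<rho>: "\<rho> > 0" "cball w0 \<rho> \<subseteq> N" by (meson open_contains_cball)
      have lt1: "exp t2 < 1" using t by simp
      have sub: "cball w0 \<rho> \<subseteq> ball 0 1" 
      proof
        fix w assume "w \<in> cball w0 \<rho>"
        then have "cmod w < exp t2" using \<rho>(2) unfolding N_def by blast
        also note lt1
        finally show "w \<in> ball 0 1" by simp
      qed
      \<comment> \<open>On the circle of radius \<open>\<rho>\<close> about \<open>e\<close>, the
        square of \<open>cmod w\<close> is the affine expression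
        \<open>\<rho>\<^sup>2 - e\<^sup>2 + 2 * e * Re w\<close>. Substituting it turns the bound
        \<open>f s + q s - q (ln (cmod w))\<close> into \<open>Re (F w)\<close>; \<open>k\<close>
        collects the constants.\<close>
      define k where "k = f s + q s + f t1 - b * t1 - \<epsilon> * (\<rho>\<^sup>2 - e\<^sup>2)"
      define F where "F w = of_real k + of_real b * Ln w - of_real (2 * \<epsilon> * e) * w" for w
      have hol: "F holomorphic_on cball w0 \<rho>" unfolding F_def
        by (intro holomorphic_intros) (use \<rho>(2) in \<open>auto simp: N_def complex_nonpos_Reals_iff\<close>)
      have "g (w0 + of_real \<rho> * cis \<theta>) \<le> ereal (Re (F (w0 + of_real \<rho> * cis \<theta>)))" for \<theta>
      proof -
        define w where "w = w0 + of_real \<rho> * cis \<theta>"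
        have "w \<in> cball w0 \<rho>" using \<rho>(1) by (simp add: w_def dist_norm norm_mult)
        then have w: "exp t1 < cmod w" "cmod w < exp t2" "0 < Re w" using \<rho>(2) by (auto simp: N_def)
        then have w0: "w \<noteq> 0" by auto
        have w1: "cmod w < 1" using w(2) lt1 by (rule less_trans)
        have "t1 < ln (cmod w)" "ln (cmod w) < t2"
          using w w0 by (metis ln_exp ln_less_cancel_iff exp_gt_zero zero_less_norm_iff)+
        then have *: "f (ln (cmod w)) \<le> f s + q s - q (ln (cmod w))" using smax[of "ln (cmod w)"] by simp
        have "exp (2 * ln (cmod w)) = (cmod w)\<^sup>2"
          using w0 by (simp add: exp_double)
        also have "\<dots> = (e + \<rho> * cos \<theta>)\<^sup>2 + (\<rho> * sin \<theta>)\<^sup>2"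
          by (simp add: cmod_power2 w_def w0_def)
        also have "\<dots> = e\<^sup>2 + 2 * e * (\<rho> * cos \<theta>) + \<rho>\<^sup>2 * ((cos \<theta>)\<^sup>2 + (sin \<theta>)\<^sup>2)"
          by algebra
        also have "\<dots> = \<rho>\<^sup>2 - e\<^sup>2 + 2 * e * Re w"
          unfolding sin_cos_squared_add2 by (simp add: w_def w0_def power2_eq_square algebra_simps)
        finally have sq: "exp (2 * ln (cmod w)) = \<rho>\<^sup>2 - e\<^sup>2 + 2 * e * Re w" .
        have "f s + q s - q (ln (cmod w)) = Re (F w)"
          unfolding q_def[of "ln (cmod w)"] sq using w0 by (simp add: F_def k_def l_def algebra_simps)
        with * gl[OF w0 w1] show ?thesis unfolding w_def[symmetric] by simp
      qed
      then have "circle_mean g w0 \<rho> \<le> ereal (Re (F w0))"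
        unfolding circle_mean_Re_holomorphic[OF hol \<rho>(1), symmetric] by (rule circle_mean_mono)
      moreover have "g w0 \<le> circle_mean g w0 \<rho>" using sh \<rho>(1) sub by (simp add: subharmonic_on_def)
      moreover have "g w0 = ereal (f s)" unfolding w0_def e_def using s' t by (intro gf) simp
      ultimately have "f s \<le> Re (F w0)" by (metis ereal_less_eq(3) order_trans)
      also have "Ln w0 = of_real s" using e by (simp add: w0_def e_def Ln_of_real)
      \<comment> \<open>At the centre the affine expression is
        \<open>\<rho>\<^sup>2 + e\<^sup>2\<close> instead of \<open>e\<^sup>2\<close>, hence the
        deficit \<open>\<epsilon> * \<rho>\<^sup>2\<close>.\<close>
      then have "Re (F w0) = f s - \<epsilon> * \<rho>\<^sup>2"
        unfolding F_def k_def q_def exp_double e_def[symmetric]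
        by (simp add: w0_def l_def power2_eq_square algebra_simps)
      finally have "\<epsilon> * \<rho>\<^sup>2 \<le> 0" by simp
      moreover have "0 < \<epsilon> * \<rho>\<^sup>2" using \<epsilon> \<rho>(1) by (intro mult_pos_pos zero_less_power)
      ultimately show False by simp
    qed
  qed simp
  then show ?thesis by (simp add: f_def[abs_def])
qed

section \<open>Convex functions of one real variable\<close>

text \<open>A decrease from \<open>a\<close> to \<open>b\<close> with slope \<open>-k\<close>
  propagates to the left by convexity: \<open>f s\<close> is at least
  \<open>f a + k * (a - s)\<close>, which is unbounded as \<open>s\<close> tends to minus
  infinity.\<close>

lemma convex_bounded_above_at_bot_imp_mono:
  fixes f :: "real \<Rightarrow> real"
  assumes cv: "convex_on {..<c} f" and bd: "\<forall>\<^sub>F t in at_bot. f t \<le> C"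
  shows "mono_on {..<c} f"
proof (rule mono_onI, rule ccontr)
  fix a b assume ab: "a \<in> {..<c}" "b \<in> {..<c}" "a \<le> b" "\<not> f a \<le> f b"
  then have lt: "a < b" by (auto simp: less_le)
  define k where "k = (f a - f b) / (b - a)"
  have k: "k > 0" using ab lt by (simp add: k_def)
  \<comment> \<open>Left of \<open>a - (C - f a) / k\<close> the line
    \<open>f a + k * (a - s)\<close> exceeds \<open>C\<close>.\<close>
  have "\<forall>\<^sub>F s in at_bot. s < min a (a - (C - f a) / k)" by (rule eventually_gt_at_bot)
  with bd obtain s where s: "f s \<le> C" "s < a" "s < a - (C - f a) / k"
    using eventually_happens[OF eventually_conj] by fastforce
  have "(f s - f a) / (s - a) \<le> (f s - f b) / (s - b)"
    using convex_on_slope_le(1)[OF cv, of s b a] s ab lt by simp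
  also have "\<dots> \<le> (f a - f b) / (a - b)"
    using convex_on_slope_le(2)[OF cv, of s b a] s ab lt by simp
  also have "\<dots> = - k" using lt by (simp add: k_def field_simps)
  finally have "k * (a - s) \<le> f s - f a" using s(2) by (simp add: field_simps)
  moreover have "k * (a - s) > C - f a" using s(3) k by (simp add: field_simps)
  ultimately show False using s(1) by simp
qed

text \<open>The difference quotients from \<open>x\<close> are non-decreasing and non-negative, so
  they converge from the right to their infimum. The derivative thus exists,
  \<open>vector_derivative\<close> returns its true value, and the quotient at \<open>y\<close>
  bounds it.\<close>

lemma convex_mono_right_derivative_bounds:
  fixes f :: "real \<Rightarrow> real"
  assumes cv: "convex_on {..<c} f" and mono: "mono_on {..<c} f" and xy: "x < y" "y < c"
  shows "vector_derivative f (at_right x) \<in> {0..(f y - f x) / (y - x)}"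
proof -
  define q where "q t = (f t - f x) / (t - x)" for t
  have qmono: "q a \<le> q b" if "x < a" "a \<le> b" "b < c" for a b
  proof (cases "a = b")
    case False
    then have "(f x - f a) / (x - a) \<le> (f x - f b) / (x - b)"
      using convex_on_slope_le(1)[OF cv, of x b a] that by simp
    then show ?thesis by (metis q_def minus_divide_divide minus_diff_eq)
  qed simp
  have q0: "0 \<le> q a" if "x < a" "a < c" for a
    using mono_onD[OF mono, of x a] that by (simp add: q_def)
  define D where "D = Inf (q ` ({x<..} \<inter> {..<c}))"
  have "(q \<longlongrightarrow> D) (at x within ({x<..} \<inter> {..<c}))"
    unfolding D_def by (rule Lim_right_bound[where K = 0]) (auto intro: qmono q0)
  moreover have "at x within ({x<..} \<inter> {..<c}) = at_right x"
    by (rule at_within_nhd[of _ "{..<c}"]) (use xy in auto)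
  ultimately have lim: "(q \<longlongrightarrow> D) (at_right x)" by simp
  then have "(f has_vector_derivative D) (at_right x)"
    by (simp add: has_real_derivative_iff_has_vector_derivative[symmetric] has_field_derivative_iff q_def[abs_def])
  then have "vector_derivative f (at_right x) = D" by (intro vector_derivative_within) auto
  moreover have ev: "\<forall>\<^sub>F t in at_right x. t \<in> {x<..<y}" using xy by (simp add: eventually_at_right_less eventually_at_right_field exI[of _ y])
  then have "\<forall>\<^sub>F t in at_right x. 0 \<le> q t" "\<forall>\<^sub>F t in at_right x. q t \<le> q y"
    by (rule eventually_mono; use xy in \<open>auto intro!: q0 qmono\<close>)+
  then have "0 \<le> D" "D \<le> q y"
    using tendsto_lowerbound[OF lim] tendsto_upperbound[OF lim] by auto
  ultimately show ?thesis by (simp add: q_def)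
qed

section \<open>Slope bounds uniform in the direction\<close>

lemma norm_vector_scalar_mult_complex:
  fixes v :: "complex^'n"
  shows "norm (c *s v) = cmod c * norm v"
  by (simp add: norm_vec_def norm_mult flip: L2_set_right_distrib)

text \<open>\<open>K\<close> is the maximum of \<open>u\<close> on the sphere of radius
  \<open>exp (-1)\<close> minus \<open>u 0\<close>, so it does not depend on the direction. The
  condition \<open>A > 1\<close> puts \<open>- A\<close> to the left of \<open>-1\<close>, the right
  end of the chord.\<close>

lemma circular_family_slope_bounds:
  fixes u :: "complex^'n \<Rightarrow> ereal"
  assumes u: "u \<in> circular_family (ball 0 1)" and u0: "u 0 > -\<infinity>"
  obtains K where "\<And>\<zeta> A. \<zeta> \<in> complex_directions \<Longrightarrow> A > 1 \<Longrightarrow>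
    vector_derivative (\<lambda>t. real_of_ereal (radial u \<zeta> t)) (at_right (- A)) \<in> {0..K / (A - 1)}"
proof -
  note norm_smult = norm_vector_scalar_mult_complex
  have psh: "plurisubharmonic_on (ball 0 1) u" and lb: "locally_bounded_on (ball 0 1 - {0}) u"
    and rot: "\<And>\<theta> z. z \<in> ball 0 1 \<Longrightarrow> u (cis \<theta> *s z) = u z"
    using u by (auto simp: circular_family_def)
  have lt: "u z < \<infinity>" if "z \<in> ball 0 1" for z using psh that by (auto simp: plurisubharmonic_on_def)
  have usc: "usc_on (ball 0 1) u" using psh by (auto simp: plurisubharmonic_on_def)
  have fin: "\<bar>u z\<bar> \<noteq> \<infinity>" if z: "z \<in> ball 0 1" "z \<noteq> 0" for z
  proof -
    obtain C where "\<bar>u z\<bar> \<le> ereal C" using lb z unfolding locally_bounded_on_def by blast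
    then show ?thesis by auto
  qed
  obtain c0 where c0: "u 0 = ereal c0" using u0 lt[of 0] by (cases "u 0") auto
  let ?S = "sphere (0 :: complex^'n) (exp (-1))"
  have S: "?S \<subseteq> ball 0 1" by auto
  have "usc_on ?S u" using usc S unfolding usc_on_def by (meson at_le filter_leD subsetD)
  then obtain z0 where z0: "z0 \<in> ?S" "\<And>z. z \<in> ?S \<Longrightarrow> u z \<le> u z0"
    using usc_attains_max[of ?S u] by auto
  obtain C where C0: "u z0 = ereal C" 
    using fin[of z0] z0(1) S by (cases "z0 = 0"; cases "u z0") auto
  have C: "u z \<le> ereal C" if "norm z = exp (-1)" for z
    unfolding C0[symmetric] by (rule z0(2)) (use that in simp)
  show ?thesis
  proof (rule that[of "C - c0"])
    fix \<zeta> :: "(complex^'n) set" and A :: real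
    assume "\<zeta> \<in> complex_directions" and A: "A > 1"
    then obtain v' :: "complex^'n" where v': "v' \<noteq> 0" "\<zeta> = vec.span {v'}" by (auto simp: complex_directions_def)
    \<comment> \<open>\<open>radial_span\<close> asks for a unit vector; rescaling leaves the line
      unchanged.\<close>
    define v where "v = of_real (inverse (norm v')) *s v'"
    have v: "norm v = 1" using v' by (simp add: v_def norm_smult norm_inverse)
    have "v' = of_real (norm v') *s v" using v' by (simp add: v_def)
    then have "v' \<in> vec.span {v}" by (metis insertI1 vec.span_base vec.span_scale)
    moreover have "v \<in> vec.span {v'}" unfolding v_def by (simp add: vec.span_base vec.span_scale)
    ultimately have "vec.span {v} = vec.span {v'}" by (simp add: vec.span_eq)
    with v' have \<zeta>: "\<zeta> = vec.span {v}" by simp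
    define g where "g w = u (w *s v)" for w
    have "{w. w *s v \<in> ball 0 1} = ball 0 1" by (auto simp: norm_smult v)
    moreover have "subharmonic_on {w. 0 + w *s v \<in> ball 0 1} (\<lambda>w. u (0 + w *s v))"
      using psh unfolding plurisubharmonic_on_def by blast
    ultimately have sh: "subharmonic_on (ball 0 1) g"
      unfolding g_def[abs_def] add_0_left by metis
    have grot: "g (cis \<theta> * w) = g w" if "w \<in> ball 0 1" for \<theta> w
      using rot[of "w *s v" \<theta>] that by (simp add: g_def norm_smult v)
    have gfin: "\<bar>g w\<bar> \<noteq> \<infinity>" if "w \<in> ball 0 1" "w \<noteq> 0" for w
    proof -
      have "w *s v \<noteq> 0" using v that(2) by auto
      then show ?thesis using fin[of "w *s v"] that(1) by (simp add: g_def norm_smult v)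
    qed
    let ?f = "\<lambda>t. real_of_ereal (radial u \<zeta> t)"
    have fg: "?f t = real_of_ereal (g (of_real (exp t)))" if "t < 0" for t
      unfolding \<zeta> g_def radial_span[OF u v that] ..
    have fg': "ereal (?f t) = g (of_real (exp t))" if "t < 0" for t
      using gfin[of "of_real (exp t)"] that by (simp add: fg ereal_real)
    \<comment> \<open>\<open>?f\<close> is known to agree with the profile of \<open>g\<close> only
      for negative arguments, so convexity is transferred pointwise.\<close>
    have cv: "convex_on {..<0} ?f"
    proof (rule convex_on_linorderI)
      fix a x y :: real assume *: "0 < a" "a < 1" "x \<in> {..<0}" "y \<in> {..<0}"
      then have "(1 - a) * x + a * y < 0" by (intro convex_bound_lt) auto
      then show "?f ((1 - a) *\<^sub>R x + a *\<^sub>R y) \<le> (1 - a) * ?f x + a * ?f y"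
        using convex_onD[OF convex_on_radial_subharmonic[OF sh grot gfin], of a x y] * by (simp add: fg)
    qed simp
    have g0: "g 0 = ereal c0" by (simp add: g_def c0)
    \<comment> \<open>Semicontinuity at the origin supplies the upper bound near minus infinity that
      monotonicity requires; any real above \<open>c0\<close> would serve.\<close>
    have "\<forall>\<^sub>F w in nhds 0. g w < ereal (c0 + 1)"
      by (rule usc_on_open_eventually_nhds[of "ball 0 1"])
         (use sh in \<open>auto simp: subharmonic_on_def g0\<close>)
    moreover have "((\<lambda>t. complex_of_real (exp t)) \<longlongrightarrow> 0) at_bot"
      using tendsto_of_real[OF exp_at_bot] by simp
    ultimately have "\<forall>\<^sub>F t in at_bot. g (of_real (exp t)) < ereal (c0 + 1)"
      by (rule eventually_compose_filterlim)
    then have "\<forall>\<^sub>F t in at_bot. ?f t \<le> c0 + 1"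
      using eventually_gt_at_bot[of 0] by eventually_elim (metis fg' less_imp_le ereal_less_eq(3))
    with cv have mono: "mono_on {..<0} ?f" by (rule convex_bounded_above_at_bot_imp_mono)
    have ge: "c0 \<le> ?f t" if "t < 0" for t
    proof -
      have "g 0 \<le> circle_mean g 0 (exp t)"
        using sh that by (simp add: subharmonic_on_def cball_subset_ball_iff)
      \<comment> \<open>On this circle \<open>g\<close> is constantly \<open>?f t\<close>; writing
        the constant as the real part of a constant holomorphic function lets the mean value
        property compute its mean.\<close>
      also have "\<dots> \<le> circle_mean (\<lambda>w. ereal (Re (of_real (?f t)))) 0 (exp t)"
        by (rule circle_mean_mono) (use that in \<open>simp add: fg' mult.commute[of _ "cis _"] grot\<close>)
      also have "\<dots> = ereal (?f t)"
        by (subst circle_mean_Re_holomorphic) auto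
      finally show ?thesis by (simp add: g0)
    qed
    have le: "?f (-1) \<le> C"
    proof -
      have "ereal (?f (-1)) \<le> ereal C"
        unfolding fg'[of "-1", simplified] g_def by (rule C) (simp add: norm_smult v)
      then show ?thesis by simp
    qed
    have "vector_derivative ?f (at_right (- A)) \<in> {0..(?f (-1) - ?f (- A)) / (-1 - (- A))}"
      by (rule convex_mono_right_derivative_bounds[OF cv mono]) (use A in auto)
    moreover have "(?f (-1) - ?f (- A)) / (-1 - (- A)) \<le> (C - c0) / (A - 1)"
      using ge[of "- A"] le A by (auto intro!: divide_right_mono)
    ultimately show "vector_derivative ?f (at_right (- A)) \<in> {0..(C - c0) / (A - 1)}" by auto
  qed
qed

theorem lemma2p3:
  fixes u :: "complex^'n \<Rightarrow> ereal"
  assumes "u \<in> circular_family (ball 0 1)"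
    and "u 0 > -\<infinity>"
  shows "max_directional_lelong u = 0"
proof -
  obtain K where K: "\<And>\<zeta> A. \<zeta> \<in> complex_directions \<Longrightarrow> A > 1 \<Longrightarrow>
    vector_derivative (\<lambda>t. real_of_ereal (radial u \<zeta> t)) (at_right (- A)) \<in> {0..K / (A - 1)}"
    using circular_family_slope_bounds[OF assms] by blast
  \<comment> \<open>The lower bound 0 for the supremum needs at least one direction, as the supremum
    over the empty set is minus infinity.\<close>
  have "axis undefined 1 \<noteq> (0 :: complex^'n)" by (simp add: axis_eq_0_iff)
  then obtain \<zeta>0 :: "(complex^'n) set" where \<zeta>0: "\<zeta>0 \<in> complex_directions"
    unfolding complex_directions_def by blast
  have gt1: "\<forall>\<^sub>F A in at_top. A > (1 :: real)" by (rule eventually_gt_at_top)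
  have "((\<lambda>A::real. K / (A - 1)) \<longlongrightarrow> 0) at_top" by real_asymp
  then have lim: "((\<lambda>A. ereal (K / (A - 1))) \<longlongrightarrow> 0) at_top"
    using tendsto_ereal by (fastforce simp: zero_ereal_def)
  have lower: "\<forall>\<^sub>F A in at_top. 0 \<le> max_slope u A"
    using gt1
  proof eventually_elim
    case (elim A)
    with K[OF \<zeta>0] show ?case unfolding max_slope_def
      by (intro SUP_upper2[OF \<zeta>0]) auto
  qed
  have upper: "\<forall>\<^sub>F A in at_top. max_slope u A \<le> ereal (K / (A - 1))"
    using gt1
  proof eventually_elim
    case (elim A)
    with K show ?case unfolding max_slope_def by (intro SUP_least) auto
  qed
  have "(max_slope u \<longlongrightarrow> 0) at_top"
    by (rule tendsto_sandwich[OF lower upper tendsto_const lim])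
  then show ?thesis unfolding max_directional_lelong_def by (rule tendsto_Lim[rotated]) simp
qed

end
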